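(* Let $K\ge 2$, $0<p_1<\dots<p_K<p_{K+1}\le 1$, let $A\subset(1,\infty)$ be compact, $\alpha_0\in A$, and let $\{Y_i\}_{i=1}^n$ be i.i.d. Pareto with exponent $\alpha_0$ and minimum size $c>0$. Let $\widehat W$ be (possibly random, depending on $n$) symmetric positive definite $(K-1)\times(K-1)$ weighting matrices with $\widehat W\xrightarrow{p}W$ as $n\to\infty$, where $W$ is positive definite. Let $\widehat\alpha$ be the minimum distance estimator $$\widehat\alpha=\operatorname*{arg\,min}_{\alpha\in A}\,(r(\alpha)-\bar s)^\top\widehat W(r(\alpha)-\bar s),$$ where $\bar s$ and $r(\alpha)$ are as defined in the context. Then $\widehat\alpha\xrightarrow{p}\alpha_0$ as $n\to\infty$.
   Context: Pareto with exponent $\alpha_0$ and minimum size $c$ means the CDF is $F(y)=1-(y/c)^{-\alpha_0}$ for $y\ge c$. Let $Y_{(1)}\ge\dots\ge Y_{(n)}$ denote the order statistics in decreasing order. The top income shares are $$S_k=\frac{\sum_{i=1}^{\lfloor np_k\rfloor}Y_{(i)}}{\sum_{i=1}^n Y_{(i)}},\quad k=1,\dots,K+1,$$ and the self-normalized non-overlapping top income shares are $$\bar s=(\bar s_1,\dots,\bar s_{K-1})^\top=\left(\frac{S_2-S_1}{S_{K+1}-S_K},\dots,\frac{S_K-S_{K-1}}{S_{K+1}-S_K}\right)^\top.$$ For $\alpha>1$, with $\xi=1/\alpha$, $r(\alpha)=(r_1(\alpha),\dots,r_{K-1}(\alpha))^\top$ where $$r_k(\alpha)=\frac{p_{k+1}^{1-\xi}-p_k^{1-\xi}}{p_{K+1}^{1-\xi}-p_K^{1-\xi}}.$$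 *)

theory Defs
  imports "HOL-Probability.Probability"
begin

definition tendsto_in_prob ::
    "'a measure \<Rightarrow> (nat \<Rightarrow> 'a \<Rightarrow> 'b::metric_space) \<Rightarrow> 'b \<Rightarrow> bool" where
  "tendsto_in_prob M X l \<longleftrightarrow>
     (\<forall>\<epsilon>>0. (\<lambda>n. measure M {\<omega> \<in> space M. dist (X n \<omega>) l > \<epsilon>}) \<longlonglongrightarrow> 0)"

definition pareto_cdf :: "real \<Rightarrow> real \<Rightarrow> real \<Rightarrow> real" where
  "pareto_cdf \<alpha> c y = (if y \<ge> c then 1 - (y / c) powr (- \<alpha>) else 0)"

text \<open>
  A sample of size \<open>n\<close> is given by \<open>y 1, \<dots>, y n\<close>, and \<open>order_stat n y i\<close> is its
  \<open>i\<close>-th largest value, for \<open>1 \<le> i \<le> n\<close>.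
\<close>

definition order_stat :: "nat \<Rightarrow> (nat \<Rightarrow> real) \<Rightarrow> nat \<Rightarrow> real" where
  "order_stat n y i = rev (sort (map y [1..<Suc n])) ! (i - 1)"

definition top_share :: "nat \<Rightarrow> (nat \<Rightarrow> real) \<Rightarrow> real \<Rightarrow> real" where
  "top_share n y q =
     (\<Sum>i = 1..nat \<lfloor>real n * q\<rfloor>. order_stat n y i) / (\<Sum>i = 1..n. order_stat n y i)"

definition norm_share :: "nat \<Rightarrow> (nat \<Rightarrow> real) \<Rightarrow> nat \<Rightarrow> (nat \<Rightarrow> real) \<Rightarrow> nat \<Rightarrow> real" where
  "norm_share K p n y k =
     (top_share n y (p (k + 1)) - top_share n y (p k)) /
     (top_share n y (p (K + 1)) - top_share n y (p K))"

definition norm_share_limit :: "nat \<Rightarrow> (nat \<Rightarrow> real) \<Rightarrow> real \<Rightarrow> nat \<Rightarrow> real" where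
  "norm_share_limit K p \<alpha> k =
     (let \<xi> = 1 / \<alpha> in
      (p (k + 1) powr (1 - \<xi>) - p k powr (1 - \<xi>)) /
      (p (K + 1) powr (1 - \<xi>) - p K powr (1 - \<xi>)))"

text \<open>
  Vectors with the \<open>K - 1\<close> coordinates \<open>1, \<dots>, K - 1\<close> live in \<open>real ^ 'k\<close>, where
  \<open>idx\<close> is a bijection from \<open>'k\<close> to \<open>{1..K - 1}\<close> naming the coordinates.
\<close>

definition s_vec ::
    "('k::finite \<Rightarrow> nat) \<Rightarrow> nat \<Rightarrow> (nat \<Rightarrow> real) \<Rightarrow> nat \<Rightarrow> (nat \<Rightarrow> real) \<Rightarrow> real ^ 'k" where
  "s_vec idx K p n y = (\<chi> j. norm_share K p n y (idx j))"

definition r_vec :: "('k::finite \<Rightarrow> nat) \<Rightarrow> nat \<Rightarrow> (nat \<Rightarrow> real) \<Rightarrow> real \<Rightarrow> real ^ 'k" where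
  "r_vec idx K p \<alpha> = (\<chi> j. norm_share_limit K p \<alpha> (idx j))"

definition pos_def_matrix :: "real ^ 'k ^ 'k \<Rightarrow> bool" where
  "pos_def_matrix A \<longleftrightarrow> (\<forall>x. x \<noteq> 0 \<longrightarrow> x \<bullet> (A *v x) > 0)"

end

theory Submission
  imports Defs
begin

text \<open>
  The minimum distance estimator is consistent as soon as three things are known: the weighted
  criterion is a continuous function of \<open>(\<alpha>, s, W)\<close> on a compact parameter set, the limiting criterion
  vanishes only at \<open>\<alpha>0\<close>, and the vector \<open>s\<close> of normalized shares converges to \<open>r(\<alpha>0)\<close>.

  \<^emph>\<open>Convergence of the shares.\<close> In a quotient of differences of top shares the total income
  cancels, and what remains are sums over blocks of order statistics with ranks above \<open>n p\<^sub>1\<close>. These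
  stay bounded with high probability, so the infinite variance of the sample (for \<open>\<alpha>0 \<le> 2\<close>) does no
  harm, and no law of large numbers for unbounded variables enters. Indeed, let \<open>t\<^sub>k\<close> be the level that
  is exceeded with probability \<open>p\<^sub>k\<close>. The block between the ranks \<open>n p\<^sub>k\<close> and \<open>n p\<^sub>k\<^sub>+\<^sub>1\<close> is nearly the set
  of observations in the interval from \<open>t\<^sub>k\<^sub>+\<^sub>1\<close> to \<open>t\<^sub>k\<close>: the number of observations above \<open>t\<^sub>k\<close> is \<open>n p\<^sub>k + o(n)\<close>,
  and each misplaced observation costs at most a constant \<open>L\<close> (\<open>top_sum_count_approx\<close>,
  \<open>top_sum_slice_tendsto\<close>). The sum over that interval is a sum of bounded i.i.d. variables, so it
  obeys the weak law of large numbers (\<open>weak_law_bounded\<close>, from Hoeffding's inequality), and its mean is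
  a constant multiple of \<open>p\<^sub>k\<^sub>+\<^sub>1 powr (1 - \<xi>) - p\<^sub>k powr (1 - \<xi>)\<close> (\<open>pareto_slice_mean\<close>).

  \<^emph>\<open>Identification.\<close> The last coordinate of \<open>r\<close> alone determines \<open>\<alpha>\<close>, since it is strictly
  decreasing in \<open>\<alpha>\<close> (\<open>powr_increment_ratio_strict_antimono\<close>, \<open>r_vec_inj\<close>).

  \<^emph>\<open>Passage to the minimizer.\<close> All of the above except the weak law is a statement about
  ordinary limits. The lemma \<open>tendsto_in_prob_via_sequences\<close> makes this precise: if finitely many
  statistics converge in probability, then a further quantity converges in probability provided
  that it converges along every sequence of sample sizes and sample points along which those
  statistics converge. The finitely many statistics are the empirical means of the
  indicator functions and the truncated identities above, and the distance of the weighting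
  matrix from its limit. For the minimizer the remaining claim is then a subsequence argument
  in the compact set \<open>A\<close> (\<open>argmin_tendsto\<close>).
\<close>

section \<open>Sums of the largest order statistics\<close>
definition top_sum :: "nat \<Rightarrow> (nat \<Rightarrow> real) \<Rightarrow> nat \<Rightarrow> real" where
  "top_sum n y m = (\<Sum>i = 1..m. order_stat n y i)"

definition emp_mean :: "nat \<Rightarrow> (nat \<Rightarrow> real) \<Rightarrow> (real \<Rightarrow> real) \<Rightarrow> real" where
  "emp_mean n y g = (\<Sum>i = 1..n. g (y i)) / real n"

lemma top_sum_eq_sum_list_take:
  assumes "m \<le> n"
  shows "top_sum n y m = sum_list (take m (rev (sort (map y [1..<Suc n]))))"
proof -
  have "top_sum n y m = (\<Sum>i<m. rev (sort (map y [1..<Suc n])) ! i)"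
    unfolding top_sum_def order_stat_def
    by (rule sum.reindex_bij_witness[where i = Suc and j = "\<lambda>i. i - 1"]) auto
  also have "\<dots> = sum_list (take m (rev (sort (map y [1..<Suc n]))))"
    using assms by (simp add: sum_list_sum_nth min_def atLeast0LessThan del: upt_Suc)
  finally show ?thesis .
qed

text \<open>
  In the decreasingly sorted sample the observations above \<open>t\<close> form an initial segment. This is the
  bridge from ranks to levels: a sum over the top ranks becomes a sum over the observations
  above a level, in which the sorting no longer appears.
\<close>

lemma take_count_sorted:
  "take (card {i\<in>{1..n}. t < y i}) (rev (sort (map y [1..<Suc n])))
     = filter (\<lambda>x. t < x) (rev (sort (map y [1..<Suc n])))"
proof -
  let ?zs = "rev (sort (map y [1..<Suc n]))"
  have tw: "filter (\<lambda>x. t < x) ?zs = takeWhile (\<lambda>x. t < x) ?zs"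
    using filter_equals_takeWhile_sorted_rev[of "\<lambda>x. x" ?zs t] by (simp del: upt_Suc)
  have "mset (filter (\<lambda>x. t < x) ?zs) = mset (filter (\<lambda>x. t < x) (map y [1..<Suc n]))"
    by (simp del: upt_Suc)
  then have "length (filter (\<lambda>x. t < x) ?zs) = length (filter (\<lambda>x. t < x) (map y [1..<Suc n]))"
    by (metis size_mset)
  also have "\<dots> = length (filter (\<lambda>i. t < y i) [1..<Suc n])"
    by (simp add: filter_map o_def del: upt_Suc)
  also have "\<dots> = card (set (filter (\<lambda>i. t < y i) [1..<Suc n]))"
    by (rule distinct_card[symmetric]) simp
  also have "set (filter (\<lambda>i. t < y i) [1..<Suc n]) = {i\<in>{1..n}. t < y i}" by auto
  finally show ?thesis
    using tw takeWhile_eq_take[of "\<lambda>x. t < x" ?zs] by simp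
qed

lemma card_exceedances_le: "card {i\<in>{1..n}. t < (y i :: real)} \<le> n"
proof -
  have "card {i\<in>{1..n}. t < y i} \<le> card {1..n}" by (rule card_mono) auto
  then show ?thesis by simp
qed

lemma top_sum_count:
  "top_sum n y (card {i\<in>{1..n}. t < y i}) = (\<Sum>i = 1..n. if t < y i then y i else 0)"
proof -
  let ?zs = "rev (sort (map y [1..<Suc n]))"
  have "top_sum n y (card {i\<in>{1..n}. t < y i}) = sum_list (filter (\<lambda>x. t < x) ?zs)"
    by (simp only: top_sum_eq_sum_list_take[OF card_exceedances_le] take_count_sorted)
  also have "\<dots> = sum_list (filter (\<lambda>x. t < x) (map y [1..<Suc n]))"
    by (metis mset_filter mset_rev mset_sort sum_mset_sum_list)
  also have "\<dots> = (\<Sum>x\<leftarrow>map y [1..<Suc n]. if t < x then x else 0)"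
    by (rule sum_list_map_filter'[of "\<lambda>x. x", simplified])
  also have "\<dots> = (\<Sum>i = 1..n. if t < y i then y i else 0)"
    by (simp add: o_def interv_sum_list_conv_sum_set_nat atLeastLessThanSuc_atLeastAtMost del: upt_Suc)
  finally show ?thesis .
qed

lemma top_sum_all: "top_sum n y n = (\<Sum>i = 1..n. y i)"
proof -
  have "top_sum n y n = sum_list (rev (sort (map y [1..<Suc n])))"
    by (simp add: top_sum_eq_sum_list_take del: upt_Suc)
  also have "\<dots> = sum_list (map y [1..<Suc n])"
    by (metis mset_rev mset_sort sum_mset_sum_list)
  also have "\<dots> = (\<Sum>i = 1..n. y i)"
    by (simp add: interv_sum_list_conv_sum_set_nat atLeastLessThanSuc_atLeastAtMost del: upt_Suc)
  finally show ?thesis .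
qed

lemma order_stat_in_sample:
  assumes "i \<in> {1..n}" shows "order_stat n y i \<in> y ` {1..n}"
proof -
  have "order_stat n y i \<in> set (rev (sort (map y [1..<Suc n])))"
    unfolding order_stat_def using assms by (intro nth_mem) (auto simp del: upt_Suc)
  then show ?thesis by auto
qed

lemma order_stat_le:
  assumes "card {i\<in>{1..n}. t < y i} < i" "i \<le> n"
  shows "order_stat n y i \<le> t"
proof -
  let ?zs = "rev (sort (map y [1..<Suc n]))"
  let ?N = "card {i\<in>{1..n}. t < y i}"
  have "\<not> t < ?zs ! (i - 1)"
  proof
    assume a: "t < ?zs ! (i - 1)"
    have "filter (\<lambda>x. t < x) ?zs
        = filter (\<lambda>x. t < x) ?zs @ filter (\<lambda>x. t < x) (drop ?N ?zs)"
      using filter_append[of "\<lambda>x. t < x" "take ?N ?zs" "drop ?N ?zs",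
          unfolded append_take_drop_id]
      by (simp only: take_count_sorted filter_filter conj_absorb)
    then have "filter (\<lambda>x. t < x) (drop ?N ?zs) = []" by (rule self_append_conv[THEN iffD1])
    moreover have "?zs ! (i - 1) \<in> set (drop ?N ?zs)"
      using assms by (auto simp: in_set_conv_nth nth_drop simp del: upt_Suc intro!: exI[of _ "i - 1 - ?N"])
    ultimately show False using a unfolding filter_empty_conv by blast
  qed
  then show ?thesis by (simp add: order_stat_def)
qed

text \<open>
  If at most \<open>m\<close> observations exceed \<open>L\<close>, then every order statistic of rank above \<open>m\<close> is at most \<open>L\<close>.
  So shifting the cut-off rank beyond \<open>m\<close> changes the sum by at most \<open>L\<close> per rank, however heavy the
  upper tail is.
\<close>

lemma top_sum_diff_le:
  assumes pos: "\<And>i. i \<in> {1..n} \<Longrightarrow> 0 \<le> y i"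
    and L: "card {i\<in>{1..n}. L < y i} \<le> m" and m: "m \<le> m'" "m' \<le> n"
  shows "\<bar>top_sum n y m' - top_sum n y m\<bar> \<le> L * (real m' - real m)"
proof -
  have split: "{1..m'} = {1..m} \<union> {m<..m'}" using m by auto
  have "top_sum n y m' - top_sum n y m = (\<Sum>i\<in>{m<..m'}. order_stat n y i)"
    unfolding top_sum_def split by (subst sum.union_disjoint) auto
  moreover have "(\<Sum>i\<in>{m<..m'}. order_stat n y i) \<le> of_nat (card {m<..m'}) * L"
    using L m by (intro sum_bounded_above order_stat_le) auto
  moreover have "0 \<le> (\<Sum>i\<in>{m<..m'}. order_stat n y i)"
  proof (rule sum_nonneg)
    fix i assume "i \<in> {m<..m'}"
    then have "order_stat n y i \<in> y ` {1..n}" using m by (intro order_stat_in_sample) auto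
    then show "0 \<le> order_stat n y i" using pos by auto
  qed
  ultimately show ?thesis using m by (simp add: of_nat_diff algebra_simps)
qed

text \<open>
  Compares a cut at rank \<open>m\<close> with a cut at level \<open>t\<close>. The two cuts differ in as many order statistics as
  \<open>m\<close> differs from the number of observations above \<open>t\<close>, and all of these lie below the auxiliary level \<open>L\<close>.
\<close>

lemma top_sum_count_approx:
  assumes pos: "\<And>i. i \<in> {1..n} \<Longrightarrow> 0 \<le> y i"
    and L: "card {i\<in>{1..n}. L < y i} \<le> m" "t \<le> L" and m: "m \<le> n"
  shows "\<bar>top_sum n y m - (\<Sum>i = 1..n. if t < y i then y i else 0)\<bar>
           \<le> L * \<bar>real m - real (card {i\<in>{1..n}. t < y i})\<bar>"
proof -
  let ?N = "card {i\<in>{1..n}. t < y i}"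
  have "card {i\<in>{1..n}. L < y i} \<le> ?N"
    using L by (intro card_mono) auto
  then show ?thesis
    using top_sum_diff_le[of n y L m ?N, OF pos L(1) _ card_exceedances_le]
      top_sum_diff_le[of n y L ?N m, OF pos _ _ m]
    unfolding top_sum_count by (cases "m \<le> ?N") (auto simp: abs_minus_commute)
qed

lemma emp_mean_indicator:
  "emp_mean n y (indicator {t<..}) = real (card {i\<in>{1..n}. t < y i}) / real n"
proof -
  have "(\<Sum>i = 1..n. indicator {t<..} (y i)) = (\<Sum>i\<in>{1..n}. if t < y i then 1 else (0::real))"
    by (intro sum.cong) (auto simp: indicator_def)
  also have "\<dots> = (\<Sum>i\<in>{i\<in>{1..n}. t < y i}. 1)" by (rule sum.inter_filter[symmetric]) simp
  finally show ?thesis by (simp add: emp_mean_def)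
qed

section \<open>Blocks of order statistics along convergent samples\<close>

lemma floor_fraction_tendsto:
  fixes N :: "nat \<Rightarrow> nat"
  assumes N: "filterlim N at_top sequentially" and q: "0 \<le> q"
  shows "(\<lambda>j. real (nat \<lfloor>real (N j) * q\<rfloor>) / real (N j)) \<longlonglongrightarrow> q"
proof -
  have inv: "(\<lambda>j. 1 / real (N j)) \<longlonglongrightarrow> 0"
    using filterlim_compose[OF lim_1_over_n N] .
  have ev: "eventually (\<lambda>j. 1 \<le> N j) sequentially"
    using N by (auto simp: filterlim_at_top)
  show ?thesis
  proof (rule tendsto_sandwich)
    show "(\<lambda>j. q - 1 / real (N j)) \<longlonglongrightarrow> q" using tendsto_diff[OF tendsto_const inv, of q] by simp
    show "(\<lambda>j. q) \<longlonglongrightarrow> q" by simp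
    show "\<forall>\<^sub>F j in sequentially. q - 1 / real (N j) \<le> real (nat \<lfloor>real (N j) * q\<rfloor>) / real (N j)"
      using ev
    proof eventually_elim
      case (elim j)
      have "real (N j) * q - 1 \<le> real (nat \<lfloor>real (N j) * q\<rfloor>)"
        using q by simp
      then have "(real (N j) * q - 1) / real (N j) \<le> real (nat \<lfloor>real (N j) * q\<rfloor>) / real (N j)"
        by (rule divide_right_mono) simp
      with elim show ?case by (simp add: diff_divide_distrib)
    qed
    show "\<forall>\<^sub>F j in sequentially. real (nat \<lfloor>real (N j) * q\<rfloor>) / real (N j) \<le> q"
      using ev
    proof eventually_elim
      case (elim j)
      have "real (nat \<lfloor>real (N j) * q\<rfloor>) \<le> real (N j) * q"
        using q by (simp add: of_nat_nat)
      with elim show ?case by (simp add: field_simps)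
    qed
  qed
qed

text \<open>
  After division by the sample size the error in \<open>top_sum_count_approx\<close> is \<open>L\<close> times the gap between
  \<open>\<lfloor>n q\<rfloor> / n\<close> and the fraction of observations above \<open>t\<close>; both tend to \<open>q\<close>. The condition \<open>l < q\<close> makes
  the exceedances of \<open>L\<close> eventually fewer than \<open>\<lfloor>n q\<rfloor>\<close>.
\<close>

lemma top_sum_approx_tendsto:
  fixes N :: "nat \<Rightarrow> nat" and y :: "nat \<Rightarrow> nat \<Rightarrow> real"
  assumes N: "filterlim N at_top sequentially"
    and pos: "\<And>j i. i \<in> {1..N j} \<Longrightarrow> 0 \<le> y j i"
    and q: "0 < q" "q \<le> 1" "l < q" and t: "t \<le> L"
    and limL: "(\<lambda>j. emp_mean (N j) (y j) (indicator {L<..})) \<longlonglongrightarrow> l"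
    and limt: "(\<lambda>j. emp_mean (N j) (y j) (indicator {t<..})) \<longlonglongrightarrow> q"
  shows "(\<lambda>j. top_sum (N j) (y j) (nat \<lfloor>real (N j) * q\<rfloor>) / real (N j)
             - emp_mean (N j) (y j) (\<lambda>x. if t < x then x else 0)) \<longlonglongrightarrow> 0"
proof -
  define m where "m j = nat \<lfloor>real (N j) * q\<rfloor>" for j
  define u where "u j = real (m j) / real (N j)" for j
  define c where "c s j = emp_mean (N j) (y j) (indicator {s<..})" for s j
  have u: "u \<longlonglongrightarrow> q"
    unfolding u_def m_def using floor_fraction_tendsto[OF N] q by simp
  have lims: "c L \<longlonglongrightarrow> l" "c t \<longlonglongrightarrow> q" using limL limt unfolding c_def .
  have m_le: "m j \<le> N j" for j
  proof -
    have "real (N j) * q \<le> real (N j)" using q by (simp add: mult_left_le)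
    then show ?thesis unfolding m_def by (simp add: nat_le_iff floor_le_iff)
  qed
  have "eventually (\<lambda>j. 0 < u j - c L j) sequentially"
    using order_tendstoD(1)[OF tendsto_diff[OF u lims(1)], of 0] q by simp
  moreover have "eventually (\<lambda>j. 1 \<le> N j) sequentially"
    using N by (auto simp: filterlim_at_top)
  ultimately have "eventually (\<lambda>j. norm (top_sum (N j) (y j) (m j) / real (N j)
      - emp_mean (N j) (y j) (\<lambda>x. if t < x then x else 0)) \<le> L * \<bar>u j - c t j\<bar>) sequentially"
  proof eventually_elim
    case (elim j)
    define k where "k s = real (card {i\<in>{1..N j}. s < y j i})" for s
    define S where "S = (\<Sum>i = 1..N j. if t < y j i then y j i else 0)"
    have n: "0 < real (N j)" using elim by simp
    have "k L \<le> real (m j)"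
      using elim n by (simp add: c_def u_def emp_mean_indicator k_def field_simps)
    then have "\<bar>top_sum (N j) (y j) (m j) - S\<bar> \<le> L * \<bar>real (m j) - k t\<bar>"
      unfolding k_def S_def using pos t m_le by (intro top_sum_count_approx) auto
    then have "\<bar>top_sum (N j) (y j) (m j) - S\<bar> / real (N j) \<le> L * \<bar>real (m j) - k t\<bar> / real (N j)"
      using n by (intro divide_right_mono) auto
    moreover have "c t j = k t / real (N j)" by (simp only: c_def emp_mean_indicator k_def)
    moreover have "emp_mean (N j) (y j) (\<lambda>x. if t < x then x else 0) = S / real (N j)"
      by (simp only: emp_mean_def S_def)
    ultimately show ?case
      using n by (simp add: u_def abs_divide flip: diff_divide_distrib)
  qed
  moreover have "(\<lambda>j. L * \<bar>u j - c t j\<bar>) \<longlonglongrightarrow> 0"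
    using tendsto_mult[OF tendsto_const tendsto_rabs[OF tendsto_diff[OF u lims(2)]], of L] by simp
  ultimately show ?thesis unfolding m_def by (rule Lim_null_comparison)
qed

text \<open>
  Each of the two top sums may diverge, for want of control over the largest observations. Their
  difference is, up to a vanishing error, the contribution of the observations between the levels.
\<close>

lemma top_sum_slice_tendsto:
  fixes N :: "nat \<Rightarrow> nat" and y :: "nat \<Rightarrow> nat \<Rightarrow> real"
  assumes N: "filterlim N at_top sequentially"
    and pos: "\<And>j i. i \<in> {1..N j} \<Longrightarrow> 0 \<le> y j i"
    and q: "0 < q" "q \<le> q'" "q' \<le> 1" "l < q" and t: "t' \<le> t" "t \<le> L"
    and limL: "(\<lambda>j. emp_mean (N j) (y j) (indicator {L<..})) \<longlonglongrightarrow> l"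
    and limt: "(\<lambda>j. emp_mean (N j) (y j) (indicator {t<..})) \<longlonglongrightarrow> q"
    and limt': "(\<lambda>j. emp_mean (N j) (y j) (indicator {t'<..})) \<longlonglongrightarrow> q'"
    and limv: "(\<lambda>j. emp_mean (N j) (y j) (\<lambda>x. x * indicator {t'<..t} x)) \<longlonglongrightarrow> v"
  shows "(\<lambda>j. (top_sum (N j) (y j) (nat \<lfloor>real (N j) * q'\<rfloor>)
              - top_sum (N j) (y j) (nat \<lfloor>real (N j) * q\<rfloor>)) / real (N j)) \<longlonglongrightarrow> v"
proof -
  have slice: "emp_mean n z (\<lambda>x. x * indicator {t'<..t} x) =
      emp_mean n z (\<lambda>x. if t' < x then x else 0) - emp_mean n z (\<lambda>x. if t < x then x else 0)" for n z
    unfolding emp_mean_def diff_divide_distrib[symmetric] sum_subtractf[symmetric]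
    using t by (intro arg_cong2[where f = "(/)"] sum.cong) (auto simp: indicator_def)
  have a: "(\<lambda>j. top_sum (N j) (y j) (nat \<lfloor>real (N j) * q\<rfloor>) / real (N j)
             - emp_mean (N j) (y j) (\<lambda>x. if t < x then x else 0)) \<longlonglongrightarrow> 0"
    by (rule top_sum_approx_tendsto[OF N pos _ _ _ _ limL limt]) (use q t in auto)
  have b: "(\<lambda>j. top_sum (N j) (y j) (nat \<lfloor>real (N j) * q'\<rfloor>) / real (N j)
             - emp_mean (N j) (y j) (\<lambda>x. if t' < x then x else 0)) \<longlonglongrightarrow> 0"
    by (rule top_sum_approx_tendsto[OF N pos _ _ _ _ limL limt']) (use q t in auto)
  show ?thesis
    using tendsto_add[OF tendsto_diff[OF b a] limv]
    unfolding slice by (simp add: diff_divide_distrib)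
qed

section \<open>Convergence in probability\<close>

text \<open>
  A continuous mapping theorem whose hypothesis is about deterministic sequences only. If \<open>Z\<close>
  were further than \<open>e\<close> from \<open>z\<close> at sample points where all \<open>X i\<close> are within \<open>1 / (k + 1)\<close> of their limits,
  for arbitrarily large sample sizes and every \<open>k\<close>, then such points would form a sequence that
  contradicts \<open>seq\<close>. Hence the event that \<open>Z\<close> is far from \<open>z\<close> is covered, up to a null set, by finitely many
  events of vanishing probability. The predicate \<open>P\<close> carries properties that hold almost
  surely for each fixed sample size.
\<close>

lemma (in prob_space) tendsto_in_prob_via_sequences:
  fixes X :: "'i \<Rightarrow> nat \<Rightarrow> 'a \<Rightarrow> real" and Z :: "nat \<Rightarrow> 'a \<Rightarrow> 'z::metric_space"
  assumes I: "finite I"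
    and X: "\<And>i. i \<in> I \<Longrightarrow> tendsto_in_prob M (X i) (x i)"
    and meas: "\<And>i n. i \<in> I \<Longrightarrow> 1 \<le> n \<Longrightarrow> X i n \<in> borel_measurable M"
    and P: "\<And>n. 1 \<le> n \<Longrightarrow> AE \<omega> in M. P n \<omega>"
    and seq: "\<And>N w. filterlim N at_top sequentially \<Longrightarrow>
         (\<And>j. 1 \<le> N j \<and> P (N j) (w j)) \<Longrightarrow>
         (\<And>i. i \<in> I \<Longrightarrow> (\<lambda>j. X i (N j) (w j)) \<longlonglongrightarrow> x i) \<Longrightarrow>
         (\<lambda>j. Z (N j) (w j)) \<longlonglongrightarrow> z"
  shows "tendsto_in_prob M Z z"
  unfolding tendsto_in_prob_def
proof (intro allI impI)
  fix e :: real assume e: "0 < e"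
  have "\<exists>k. \<forall>n w. 1 \<le> n \<longrightarrow> k \<le> n \<longrightarrow> P n w \<longrightarrow>
          (\<forall>i\<in>I. dist (X i n w) (x i) \<le> 1 / real (Suc k)) \<longrightarrow> dist (Z n w) z \<le> e"
  proof (rule ccontr)
    assume "\<not> ?thesis"
    then have "\<forall>k. \<exists>n w. 1 \<le> n \<and> k \<le> n \<and> P n w \<and>
          (\<forall>i\<in>I. dist (X i n w) (x i) \<le> 1 / real (Suc k)) \<and> e < dist (Z n w) z"
      unfolding not_ex not_all not_imp not_le by blast
    from choice[OF this] obtain N where "\<forall>k. \<exists>w. 1 \<le> N k \<and> k \<le> N k \<and> P (N k) w \<and>
          (\<forall>i\<in>I. dist (X i (N k) w) (x i) \<le> 1 / real (Suc k)) \<and> e < dist (Z (N k) w) z" ..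
    from choice[OF this] obtain w where Nw: "\<forall>k. 1 \<le> N k \<and> k \<le> N k \<and> P (N k) (w k) \<and>
          (\<forall>i\<in>I. dist (X i (N k) (w k)) (x i) \<le> 1 / real (Suc k)) \<and> e < dist (Z (N k) (w k)) z" ..
    have "filterlim N at_top sequentially"
      using Nw by (intro filterlim_at_top_mono[OF filterlim_ident]) (auto intro: always_eventually)
    moreover have "(\<lambda>k. X i (N k) (w k)) \<longlonglongrightarrow> x i" if "i \<in> I" for i
    proof (rule iffD2[OF tendsto_dist_iff], rule tendsto_sandwich[OF _ _ tendsto_const])
      show "\<forall>\<^sub>F k in sequentially. dist (X i (N k) (w k)) (x i) \<le> 1 / real (Suc k)"
        using Nw that by (intro always_eventually) auto
      show "(\<lambda>k. 1 / real (Suc k)) \<longlonglongrightarrow> 0"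
        using LIMSEQ_inverse_real_of_nat by (simp add: inverse_eq_divide)
    qed auto
    ultimately have "(\<lambda>k. Z (N k) (w k)) \<longlonglongrightarrow> z" using Nw by (intro seq) auto
    then have "eventually (\<lambda>k. dist (Z (N k) (w k)) z < e) sequentially"
      using e by (rule tendstoD)
    then obtain k where "dist (Z (N k) (w k)) z < e" by (auto simp: eventually_sequentially)
    then show False using Nw by (meson less_asym)
  qed
  then obtain k where k: "\<forall>n w. 1 \<le> n \<longrightarrow> k \<le> n \<longrightarrow> P n w \<longrightarrow>
          (\<forall>i\<in>I. dist (X i n w) (x i) \<le> 1 / real (Suc k)) \<longrightarrow> dist (Z n w) z \<le> e" ..
  define B where "B i n = {w \<in> space M. dist (X i n w) (x i) > 1 / real (Suc k)}" for i n
  have B_meas: "B i n \<in> events" if "i \<in> I" "1 \<le> n" for i n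
    using meas[OF that] unfolding B_def by measurable
  have bound: "prob {w \<in> space M. dist (Z n w) z > e} \<le> (\<Sum>i\<in>I. prob (B i n))" if n: "max 1 k \<le> n" for n
  proof -
    have "prob {w \<in> space M. dist (Z n w) z > e} \<le> prob (\<Union>i\<in>I. B i n)"
    proof (rule finite_measure_mono_AE)
      have "1 \<le> n" using n by simp
      from P[OF this] show "AE w in M. w \<in> {w \<in> space M. dist (Z n w) z > e} \<longrightarrow> w \<in> (\<Union>i\<in>I. B i n)"
      proof eventually_elim
        case (elim w)
        show ?case
        proof
          assume w: "w \<in> {w \<in> space M. dist (Z n w) z > e}"
          have "\<not> (\<forall>i\<in>I. dist (X i n w) (x i) \<le> 1 / real (Suc k))"
          proof
            assume "\<forall>i\<in>I. dist (X i n w) (x i) \<le> 1 / real (Suc k)"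
            then have "dist (Z n w) z \<le> e" using k[rule_format, of n w] elim n by auto
            with w show False by simp
          qed
          then show "w \<in> (\<Union>i\<in>I. B i n)" using w unfolding B_def by (auto simp: not_le)
        qed
      qed
      show "(\<Union>i\<in>I. B i n) \<in> events" using I B_meas n by (intro sets.finite_UN) auto
    qed
    also have "\<dots> \<le> (\<Sum>i\<in>I. prob (B i n))"
      using I B_meas n by (intro finite_measure_subadditive_finite) auto
    finally show ?thesis .
  qed
  have "(\<lambda>n. \<Sum>i\<in>I. prob (B i n)) \<longlonglongrightarrow> (\<Sum>i\<in>I. 0)"
    using X unfolding tendsto_in_prob_def B_def by (intro tendsto_sum) simp
  then have lim: "(\<lambda>n. \<Sum>i\<in>I. prob (B i n)) \<longlonglongrightarrow> 0" by simp
  show "(\<lambda>n. prob {w \<in> space M. dist (Z n w) z > e}) \<longlonglongrightarrow> 0"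
  proof (rule tendsto_sandwich[OF _ _ tendsto_const lim])
    show "\<forall>\<^sub>F n in sequentially. prob {w \<in> space M. dist (Z n w) z > e} \<le> (\<Sum>i\<in>I. prob (B i n))"
      using bound by (rule eventually_sequentiallyI)
  qed simp
qed

text \<open>
  Hoeffding's inequality bounds the deviation probability by a geometric sequence in \<open>n\<close>.
\<close>

lemma (in prob_space) weak_law_bounded:
  fixes Y :: "nat \<Rightarrow> 'a \<Rightarrow> real" and g :: "real \<Rightarrow> real"
  assumes indep: "indep_vars (\<lambda>_. borel) Y {1..}"
    and D: "\<And>i. 1 \<le> i \<Longrightarrow> distr M borel (Y i) = D"
    and g [measurable]: "g \<in> borel_measurable borel" and bound: "\<And>x. \<bar>g x\<bar> \<le> B"
  shows "tendsto_in_prob M (\<lambda>n w. emp_mean n (\<lambda>i. Y i w) g) (\<integral>x. g x \<partial>D)"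
  unfolding tendsto_in_prob_def
proof (intro allI impI)
  fix e :: real assume e: "0 < e"
  have Y [measurable]: "random_variable borel (Y i)" if "1 \<le> i" for i
    using indep that unfolding indep_vars_def by auto
  have B: "0 \<le> B" using bound[of 0] by simp
  let ?b = "\<lambda>n. 2 * exp (- 2 * real n * e\<^sup>2 / (B + 1 - (- B))\<^sup>2)"
  have le: "prob {w \<in> space M. dist (emp_mean n (\<lambda>i. Y i w) g) (\<integral>x. g x \<partial>D) > e} \<le> ?b n"
    if n: "1 \<le> n" for n
  proof -
    \<comment> \<open>The range is enlarged to \<open>B + 1\<close> because the inequality needs an interval of positive length,
      also when \<open>B = 0\<close>.\<close>
    interpret Hoeffding_ineq_iid M "{1..n}" "\<lambda>i w. g (Y i w)" "\<lambda>w. g (Y 1 w)" "- B" "B + 1"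
        "expectation (\<lambda>w. g (Y 1 w))"
    proof unfold_locales
      show "indep_vars (\<lambda>_. borel) (\<lambda>i w. g (Y i w)) {1..n}"
        by (rule indep_vars_compose2[OF indep_vars_subset[OF indep]]) auto
      show "distr M borel (\<lambda>w. g (Y i w)) = distr M borel (\<lambda>w. g (Y 1 w))" if "i \<in> {1..n}" for i
      proof -
        have *: "distr M borel (\<lambda>w. g (Y j w)) = distr D borel g" if "1 \<le> j" for j
          using distr_distr[OF g Y[OF that]] D[OF that] by (simp add: o_def)
        show ?thesis using *[of i] *[of 1] that by simp
      qed
      show "AE w in M. g (Y 1 w) \<in> {- B..B + 1}"
      proof (intro always_eventually allI)
        show "g (Y 1 w) \<in> {- B..B + 1}" for w using bound[of "Y 1 w"] by auto
      qed
    qed auto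
    have mean: "(\<integral>x. g x \<partial>D) = expectation (\<lambda>w. g (Y 1 w))"
      using D[of 1] integral_distr[OF Y g, of 1] by simp
    have "prob {w \<in> space M. dist (emp_mean n (\<lambda>i. Y i w) g) (\<integral>x. g x \<partial>D) > e}
        \<le> prob {w \<in> space M. \<bar>(\<Sum>i\<in>{1..n}. g (Y i w)) / real (card {1..n})
              - expectation (\<lambda>w. g (Y 1 w))\<bar> \<ge> e}"
      by (rule finite_measure_mono) (auto simp: dist_real_def emp_mean_def mean)
    also have "\<dots> \<le> 2 * exp (- 2 * real (card {1..n}) * e\<^sup>2 / (B + 1 - (- B))\<^sup>2)"
      using e B n by (intro Hoeffding_ineq_abs_ge') auto
    finally show ?thesis by simp
  qed
  have lim: "?b \<longlonglongrightarrow> 0"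
  proof -
    define r where "r = 2 * e\<^sup>2 / (B + 1 - (- B))\<^sup>2"
    have "r > 0" using e B unfolding r_def by (intro divide_pos_pos) auto
    then have "(\<lambda>n. 2 * exp (- r) ^ n) \<longlonglongrightarrow> 2 * 0"
      by (intro tendsto_mult tendsto_const LIMSEQ_power_zero) simp
    moreover have "?b n = 2 * exp (- r) ^ n" for n
      unfolding exp_of_nat_mult[symmetric] r_def by simp
    ultimately show ?thesis by simp
  qed
  show "(\<lambda>n. prob {w \<in> space M. dist (emp_mean n (\<lambda>i. Y i w) g) (\<integral>x. g x \<partial>D) > e}) \<longlonglongrightarrow> 0"
  proof (rule tendsto_sandwich[OF _ _ tendsto_const lim])
    show "\<forall>\<^sub>F n in sequentially.
        prob {w \<in> space M. dist (emp_mean n (\<lambda>i. Y i w) g) (\<integral>x. g x \<partial>D) > e} \<le> ?b n"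
      using le by (rule eventually_sequentiallyI)
  qed simp
qed

section \<open>Minimum distance estimation\<close>

text \<open>
  Otherwise some subsequence of minimizers stays away from \<open>a0\<close> and, by compactness, converges to some
  \<open>a \<in> A\<close> with \<open>a \<noteq> a0\<close>. Passing to the limit in "the criterion at the minimizer is at most the criterion at \<open>a0\<close>"
  shows that the limiting quadratic form is at most \<open>0\<close> at \<open>r a - r a0\<close>. Positive definiteness of
  the limit matrix then gives \<open>r a = r a0\<close>, which \<open>inj\<close> excludes. Taking the limit in this inequality avoids
  eigenvalue bounds on the matrices \<open>V j\<close>.
\<close>

lemma argmin_tendsto:
  fixes r :: "'p::metric_space \<Rightarrow> real ^ 'k" and V :: "nat \<Rightarrow> real ^ 'k ^ 'k"
  assumes A: "compact A" "a0 \<in> A" and r: "continuous_on A r"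
    and inj: "\<And>a. a \<in> A \<Longrightarrow> r a = r a0 \<Longrightarrow> a = a0"
    and s: "s \<longlonglongrightarrow> r a0" and V: "V \<longlonglongrightarrow> W" "pos_def_matrix W"
    and min: "eventually (\<lambda>j. is_arg_min (\<lambda>a. (r a - s j) \<bullet> (V j *v (r a - s j))) (\<lambda>a. a \<in> A) (b j))
        sequentially"
  shows "b \<longlonglongrightarrow> a0"
proof (rule ccontr)
  assume "\<not> b \<longlonglongrightarrow> a0"
  then obtain e where e: "0 < e" and fr: "\<exists>\<^sub>F j in sequentially. \<not> dist (b j) a0 < e"
    unfolding tendsto_iff by (auto simp: frequently_def)
  let ?Q = "\<lambda>j a. (r a - s j) \<bullet> (V j *v (r a - s j))"
  have "b j \<in> A \<and> ?Q j (b j) \<le> ?Q j a0" if "is_arg_min (?Q j) (\<lambda>a. a \<in> A) (b j)" for j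
    using that A(2) unfolding is_arg_min_linorder by blast
  then have "\<exists>\<^sub>F j in sequentially. b j \<in> A \<and> ?Q j (b j) \<le> ?Q j a0 \<and> e \<le> dist (b j) a0"
    using frequently_eventually_frequently[OF fr min] unfolding not_less
    by (elim frequently_elim1) blast
  then have "infinite {j. b j \<in> A \<and> ?Q j (b j) \<le> ?Q j a0 \<and> e \<le> dist (b j) a0}"
    by (simp add: frequently_cofinite flip: cofinite_eq_sequentially)
  from infinite_enumerate[OF this] obtain \<phi> :: "nat \<Rightarrow> nat" where \<phi>: "strict_mono \<phi>"
    and b: "\<And>j. b (\<phi> j) \<in> A \<and> ?Q (\<phi> j) (b (\<phi> j)) \<le> ?Q (\<phi> j) a0 \<and> e \<le> dist (b (\<phi> j)) a0"
    unfolding mem_Collect_eq by blast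
  from b have "\<forall>j. (b \<circ> \<phi>) j \<in> A" by simp
  then obtain a \<psi> where a: "a \<in> A" and \<psi>: "strict_mono \<psi>" "(b \<circ> \<phi> \<circ> \<psi>) \<longlonglongrightarrow> a"
    using A(1) unfolding compact_def by blast
  define \<tau> where "\<tau> = \<phi> \<circ> \<psi>"
  have \<tau>: "strict_mono \<tau>" unfolding \<tau>_def using \<phi> \<psi> by (simp add: strict_mono_o)
  have lim_b: "(\<lambda>j. b (\<tau> j)) \<longlonglongrightarrow> a" using \<psi> by (simp add: \<tau>_def o_def)
  have lim_s: "(\<lambda>j. s (\<tau> j)) \<longlonglongrightarrow> r a0" using LIMSEQ_subseq_LIMSEQ[OF s \<tau>] by (simp add: o_def)
  have lim_V: "(\<lambda>j. V (\<tau> j)) \<longlonglongrightarrow> W" using LIMSEQ_subseq_LIMSEQ[OF V(1) \<tau>] by (simp add: o_def)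
  have lim_r: "(\<lambda>j. r (b (\<tau> j))) \<longlonglongrightarrow> r a"
    by (rule continuous_on_tendsto_compose[OF r lim_b a]) (use b in \<open>auto simp: \<tau>_def\<close>)
  have lim_Q: "(\<lambda>j. (f j - s (\<tau> j)) \<bullet> (V (\<tau> j) *v (f j - s (\<tau> j)))) \<longlonglongrightarrow> (l - r a0) \<bullet> (W *v (l - r a0))"
    if "f \<longlonglongrightarrow> l" for f l
    unfolding inner_vec_def matrix_vector_mult_def vec_lambda_beta
    by (intro tendsto_intros tendsto_vec_nth lim_V lim_s that)
  have "(r a - r a0) \<bullet> (W *v (r a - r a0)) \<le> (r a0 - r a0) \<bullet> (W *v (r a0 - r a0))"
    by (rule LIMSEQ_le[OF lim_Q[OF lim_r] lim_Q[OF tendsto_const]])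
      (use b in \<open>auto simp: \<tau>_def\<close>)
  then have "\<not> 0 < (r a - r a0) \<bullet> (W *v (r a - r a0))" by simp
  then have "r a - r a0 = 0" using V(2) unfolding pos_def_matrix_def by blast
  then have "a = a0" using inj[OF a] by (simp only: right_minus_eq)
  have "eventually (\<lambda>j. dist (b (\<tau> j)) a < e) sequentially" using lim_b e by (rule tendstoD)
  then obtain j where "dist (b (\<tau> j)) a < e" by (auto simp: eventually_sequentially)
  then show False using b[of "\<psi> j"] \<open>a = a0\<close> by (simp add: \<tau>_def)
qed

section \<open>The Pareto distribution\<close>

text \<open>The level that a Pareto variable exceeds with probability \<open>q\<close>.\<close>

definition pareto_tail_quantile :: "real \<Rightarrow> real \<Rightarrow> real \<Rightarrow> real" where
  "pareto_tail_quantile \<alpha> c q = c * q powr (- (1 / \<alpha>))"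

lemma pareto_tail_quantile_ge:
  assumes "0 < \<alpha>" "0 < c" "0 < q" "q \<le> 1"
  shows "c \<le> pareto_tail_quantile \<alpha> c q"
proof -
  have "1 powr (- (1 / \<alpha>)) \<le> q powr (- (1 / \<alpha>))"
    using assms by (intro powr_mono2') auto
  then show ?thesis using assms unfolding pareto_tail_quantile_def by simp
qed

lemma pareto_tail_quantile_antimono:
  assumes "0 < \<alpha>" "0 < c" "0 < q" "q \<le> q'"
  shows "pareto_tail_quantile \<alpha> c q' \<le> pareto_tail_quantile \<alpha> c q"
  using assms unfolding pareto_tail_quantile_def by (intro mult_left_mono powr_mono2') auto

lemma pareto_tail_quantile_powr:
  assumes "0 < \<alpha>" "0 < c" "0 < q"
  shows "(pareto_tail_quantile \<alpha> c q / c) powr (- \<alpha>) = q"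
  using assms by (simp add: pareto_tail_quantile_def powr_powr)

text \<open>
  Rewrites the antiderivative of \<open>x\<close> times the Pareto density, at a quantile level, in terms of the
  tail probability; this is where the exponent \<open>1 - \<xi>\<close> comes from.
\<close>

lemma pareto_tail_quantile_powr_slice:
  assumes "0 < \<alpha>" "0 < c" "0 < q"
  shows "c powr \<alpha> * pareto_tail_quantile \<alpha> c q powr (1 - \<alpha>) = c * q powr (1 - 1 / \<alpha>)"
proof -
  have "(q powr (- (1 / \<alpha>))) powr (1 - \<alpha>) = q powr (1 - 1 / \<alpha>)"
    unfolding powr_powr by (rule arg_cong[where f = "(powr) q"]) (use assms in \<open>simp add: field_simps\<close>)
  then have "pareto_tail_quantile \<alpha> c q powr (1 - \<alpha>) = c powr (1 - \<alpha>) * q powr (1 - 1 / \<alpha>)"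
    using assms unfolding pareto_tail_quantile_def by (simp add: powr_mult)
  then show ?thesis using assms by (simp add: powr_add[symmetric] mult.assoc[symmetric])
qed

lemma pareto_tail_prob:
  assumes D: "real_distribution D" "\<And>y. cdf D y = pareto_cdf \<alpha> c y"
    and "0 < \<alpha>" "0 < c" "0 < q" "q \<le> 1"
  shows "(\<integral>x. indicator {pareto_tail_quantile \<alpha> c q<..} x \<partial>D) = q"
proof -
  interpret real_distribution D by fact
  let ?t = "pareto_tail_quantile \<alpha> c q"
  have c: "cdf D ?t = 1 - q"
    using pareto_tail_quantile_ge[of \<alpha> c q] pareto_tail_quantile_powr[of \<alpha> c q] assms
    by (simp add: pareto_cdf_def)
  have "prob {?t<..} = prob (space D - {..?t})" by (rule arg_cong[where f = prob]) auto
  also have "\<dots> = q" using c by (subst prob_compl) (auto simp: cdf_def)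
  finally show ?thesis by simp
qed

lemma pareto_distributed:
  assumes D: "real_distribution D" "\<And>y. cdf D y = pareto_cdf \<alpha> c y" and "0 < \<alpha>" "0 < c"
  shows "distributed D lborel (\<lambda>x. x)
           (\<lambda>x. if c \<le> x then \<alpha> * c powr \<alpha> * x powr (- \<alpha> - 1) else 0)"
proof -
  interpret real_distribution D by fact
  let ?f = "\<lambda>x. if c \<le> x then \<alpha> * c powr \<alpha> * x powr (- \<alpha> - 1) else 0"
  show ?thesis
  proof (rule distributedI_borel_atMost)
    show "(\<lambda>x. x) \<in> borel_measurable D" by measurable
    show "?f \<in> borel_measurable borel" by measurable
    show "AE x in lborel. 0 \<le> ?f x" using assms by simp
    show "emeasure D {x \<in> space D. x \<le> a} = ennreal (pareto_cdf \<alpha> c a)" for a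
      using D(2)[of a] by (simp add: emeasure_eq_measure cdf_def atMost_def)
    show "(\<integral>\<^sup>+x. ?f x * indicator {..a} x \<partial>lborel) = ennreal (pareto_cdf \<alpha> c a)" for a
    proof (cases "c \<le> a")
      case False
      then have "(\<integral>\<^sup>+x. ?f x * indicator {..a} x \<partial>lborel) = (\<integral>\<^sup>+x. 0 \<partial>(lborel :: real measure))"
        by (intro nn_integral_cong) (auto simp: indicator_def)
      then show ?thesis using False by (simp add: pareto_cdf_def)
    next
      case True
      have "(\<integral>\<^sup>+x. ?f x * indicator {..a} x \<partial>lborel)
          = (\<integral>\<^sup>+x. \<alpha> * c powr \<alpha> * x powr (- \<alpha> - 1) * indicator {c..a} x \<partial>lborel)"
        by (intro nn_integral_cong) (auto simp: indicator_def)
      also have "\<dots> = (\<integral>\<^sup>+x. ennreal (\<alpha> * c powr \<alpha> * x powr (- \<alpha> - 1)) * indicator {c..a} x \<partial>lborel)"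
        by (intro nn_integral_cong) (auto simp: indicator_def)
      also have "\<dots> = ennreal ((- (c powr \<alpha>) * a powr (- \<alpha>)) - (- (c powr \<alpha>) * c powr (- \<alpha>)))"
      proof (rule nn_integral_FTC_Icc)
        fix x assume "x \<in> {c..a}"
        then show "((\<lambda>x. - (c powr \<alpha>) * x powr (- \<alpha>)) has_real_derivative
            \<alpha> * c powr \<alpha> * x powr (- \<alpha> - 1)) (at x)"
          using assms by (auto intro!: derivative_eq_intros)
      qed (use assms True in auto)
      also have "(- (c powr \<alpha>) * a powr (- \<alpha>)) - (- (c powr \<alpha>) * c powr (- \<alpha>)) = pareto_cdf \<alpha> c a"
        using assms True by (simp add: pareto_cdf_def powr_divide powr_minus field_simps)
      finally show ?thesis .
    qed
  qed
qed

text \<open>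
  The mean is the increment of an explicit antiderivative between two quantile levels. Its factor
  \<open>\<alpha> / (\<alpha> - 1) * c\<close> is the same for all pairs of levels and cancels in quotients of slices; this is
  why the normalized shares do not depend on \<open>c\<close> in the limit.
\<close>

lemma pareto_slice_mean:
  assumes D: "real_distribution D" "\<And>y. cdf D y = pareto_cdf \<alpha> c y" and \<alpha>: "1 < \<alpha>" and c: "0 < c"
    and q: "0 < q" "q \<le> q'" "q' \<le> 1"
  shows "(\<integral>x. x * indicator {pareto_tail_quantile \<alpha> c q'<..pareto_tail_quantile \<alpha> c q} x \<partial>D)
           = \<alpha> / (\<alpha> - 1) * c * (q' powr (1 - 1 / \<alpha>) - q powr (1 - 1 / \<alpha>))"
proof -
  interpret real_distribution D by fact
  let ?f = "\<lambda>x. if c \<le> x then \<alpha> * c powr \<alpha> * x powr (- \<alpha> - 1) else 0"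
  define t where "t = pareto_tail_quantile \<alpha> c q"
  define t' where "t' = pareto_tail_quantile \<alpha> c q'"
  have t: "c \<le> t'" "t' \<le> t"
    unfolding t_def t'_def using assms
    by (auto intro!: pareto_tail_quantile_ge pareto_tail_quantile_antimono)
  define G where "G x = - (\<alpha> / (\<alpha> - 1)) * (c powr \<alpha> * x powr (1 - \<alpha>))" for x :: real
  have "(\<integral>x. x * indicator {t'<..t} x \<partial>D) = (\<integral>x. ?f x * (x * indicator {t'<..t} x) \<partial>lborel)"
    by (rule distributed_integral[symmetric, OF pareto_distributed[OF D]]) (use assms in auto)
  \<comment> \<open>Closing the interval at \<open>t'\<close> changes the integrand at a single point and makes the
    fundamental theorem of calculus applicable.\<close>
  also have "\<dots> = (\<integral>x. \<alpha> * c powr \<alpha> * x powr (- \<alpha>) * indicator {t'..t} x \<partial>lborel)"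
  proof (rule integral_cong_AE)
    have "AE x in lborel. x \<noteq> t'" by (rule AE_lborel_singleton)
    then show "AE x in lborel. ?f x * (x * indicator {t'<..t} x)
        = \<alpha> * c powr \<alpha> * x powr (- \<alpha>) * indicator {t'..t} x"
    proof eventually_elim
      case (elim x)
      have "x powr (- \<alpha> - 1) * x = x powr (- \<alpha>)" if "0 < x"
        using that by (simp add: powr_diff)
      then show ?case using elim t c by (auto simp: indicator_def)
    qed
  qed measurable
  also have "\<dots> = G t - G t'"
  proof (rule integral_FTC_Icc_real)
    show "t' \<le> t" by fact
    fix x assume x: "t' \<le> x" "x \<le> t"
    then have "0 < x" using t c by simp
    then have "(G has_real_derivative - (\<alpha> / (\<alpha> - 1)) * (c powr \<alpha> * ((1 - \<alpha>) * x powr (1 - \<alpha> - 1)))) (at x)"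
      unfolding G_def using \<alpha> by (auto intro!: derivative_eq_intros)
    moreover have "- (\<alpha> / (\<alpha> - 1)) * (1 - \<alpha>) = \<alpha>" using \<alpha> by (simp add: field_simps)
    then have "- (\<alpha> / (\<alpha> - 1)) * (c powr \<alpha> * ((1 - \<alpha>) * u)) = \<alpha> * c powr \<alpha> * u" for u
      by (metis mult.assoc mult.left_commute)
    ultimately show "(G has_real_derivative \<alpha> * c powr \<alpha> * x powr (- \<alpha>)) (at x)" by simp
    show "isCont (\<lambda>x. \<alpha> * c powr \<alpha> * x powr (- \<alpha>)) x"
      using \<open>0 < x\<close> by (intro continuous_intros) auto
  qed
  also have "\<dots> = \<alpha> / (\<alpha> - 1) * c * (q' powr (1 - 1 / \<alpha>) - q powr (1 - 1 / \<alpha>))"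
    using assms unfolding G_def t_def t'_def
    by (simp add: pareto_tail_quantile_powr_slice algebra_simps)
  finally show ?thesis unfolding t_def t'_def .
qed

section \<open>Identification\<close>

text \<open>
  Put \<open>u = x powr a\<close>, \<open>v = y powr a\<close>, \<open>w = z powr a\<close> and \<open>s = b / a > 1\<close>. By the mean value theorem for the
  power function with exponent \<open>s\<close>, the left-hand side is \<open>(v - u) / (w - v)\<close>, which is the right-hand side,
  times \<open>(\<xi> / \<eta>) powr (s - 1)\<close> with \<open>\<xi> < v < \<eta>\<close>.
\<close>

lemma powr_increment_ratio_strict_antimono:
  fixes x y z a b :: real
  assumes x: "0 < x" "x < y" "y < z" and ab: "0 < a" "a < b"
  shows "(y powr b - x powr b) / (z powr b - y powr b) < (y powr a - x powr a) / (z powr a - y powr a)"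
proof -
  define s where "s = b / a"
  define u v w where uvw: "u = x powr a" "v = y powr a" "w = z powr a"
  have s: "1 < s" using ab by (simp add: s_def)
  have ord: "0 < u" "u < v" "v < w" using x ab by (auto simp: uvw powr_less_mono2)
  have pow: "x powr b = u powr s" "y powr b = v powr s" "z powr b = w powr s"
    using ab by (simp_all add: uvw powr_powr s_def)
  have mvt: "\<exists>\<xi>. l < \<xi> \<and> \<xi> < h \<and> h powr s - l powr s = (h - l) * (s * \<xi> powr (s - 1))"
    if "0 < l" "l < h" for l h
    using that by (intro MVT2) (auto intro!: derivative_eq_intros)
  obtain \<xi> where \<xi>: "u < \<xi>" "\<xi> < v" "v powr s - u powr s = (v - u) * (s * \<xi> powr (s - 1))"
    using mvt[of u v] ord by auto
  obtain \<eta> where \<eta>: "v < \<eta>" "\<eta> < w" "w powr s - v powr s = (w - v) * (s * \<eta> powr (s - 1))"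
    using mvt[of v w] ord by auto
  have lt: "\<xi> powr (s - 1) < \<eta> powr (s - 1)"
    using \<xi> \<eta> ord s by (intro powr_less_mono2) auto
  have pos: "0 < \<xi> powr (s - 1)" "0 < \<eta> powr (s - 1)" using \<xi> \<eta> ord by auto
  have "(v powr s - u powr s) / (w powr s - v powr s)
      = (v - u) / (w - v) * (\<xi> powr (s - 1) / \<eta> powr (s - 1))"
    using s by (simp add: \<xi> \<eta>)
  also have "\<dots> < (v - u) / (w - v) * 1"
    using ord lt pos by (intro mult_strict_left_mono) auto
  finally show ?thesis by (simp add: pow uvw)
qed

text \<open>
  The coordinate \<open>K - 1\<close> compares the increments over the adjacent intervals with endpoints \<open>p (K - 1)\<close>, \<open>p K\<close>
  and \<open>p (K + 1)\<close>, so it is strictly decreasing in the exponent \<open>1 - 1 / \<alpha>\<close>.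
\<close>

lemma r_vec_inj:
  fixes idx :: "'k::finite \<Rightarrow> nat"
  assumes K: "2 \<le> K" "bij_betw idx UNIV {1..K - 1}"
    and p: "0 < p 1" "strict_mono_on {1..K + 1} p"
    and \<alpha>: "1 < \<alpha>" "1 < \<beta>" and eq: "r_vec idx K p \<alpha> = r_vec idx K p \<beta>"
  shows "\<alpha> = \<beta>"
proof (rule ccontr)
  assume ne: "\<alpha> \<noteq> \<beta>"
  have "K - 1 \<in> idx ` UNIV" using K by (auto simp: bij_betw_def)
  then obtain j where j: "idx j = K - 1" by auto
  have "r_vec idx K p \<alpha> $ j = r_vec idx K p \<beta> $ j" by (simp add: eq)
  then have eq': "norm_share_limit K p \<alpha> (K - 1) = norm_share_limit K p \<beta> (K - 1)"
    by (simp add: r_vec_def j)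
  have "1 \<le> K - 1" "K - 1 \<le> K + 1" using K by auto
  then have "p 1 \<le> p (K - 1)"
    using monotone_onD[OF strict_mono_on_imp_mono_on[OF p(2)], of 1 "K - 1"] by simp
  moreover have "p (K - 1) < p K" "p K < p (K + 1)"
    using strict_mono_onD[OF p(2), of "K - 1" K] strict_mono_onD[OF p(2), of K "K + 1"]
      \<open>1 \<le> K - 1\<close> \<open>K - 1 \<le> K + 1\<close> by auto
  ultimately have ord: "0 < p (K - 1)" "p (K - 1) < p K" "p K < p (K + 1)" using p by auto
  have lt: "norm_share_limit K p \<delta> (K - 1) < norm_share_limit K p \<gamma> (K - 1)"
    if "1 < \<gamma>" "\<gamma> < \<delta>" for \<gamma> \<delta>
    using powr_increment_ratio_strict_antimono[OF ord, of "1 - 1 / \<gamma>" "1 - 1 / \<delta>"] that K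
    by (simp add: norm_share_limit_def Let_def frac_less2)
  show False using lt[of \<alpha> \<beta>] lt[of \<beta> \<alpha>] \<alpha> ne eq' by linarith
qed

lemma r_vec_continuous:
  assumes p: "0 < p 1" "strict_mono_on {1..K + 1} p" and K: "1 \<le> K"
    and idx: "\<And>j. idx j \<in> {1..K}" and A: "A \<subseteq> {1<..}"
  shows "continuous_on A (r_vec idx K p)"
proof -
  have pos: "0 < p k" if "k \<in> {1..K + 1}" for k
    using monotone_onD[OF strict_mono_on_imp_mono_on[OF p(2)], of 1 k] that p(1) by auto
  have "p (K + 1) powr (1 - 1 / \<alpha>) \<noteq> p K powr (1 - 1 / \<alpha>)" if "\<alpha> \<in> A" for \<alpha>
    using powr_less_mono2[of "1 - 1 / \<alpha>" "p K" "p (K + 1)"] that A pos[of K] K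
      strict_mono_onD[OF p(2), of K "K + 1"] by auto
  moreover have "p (idx j) \<noteq> 0" "p (Suc (idx j)) \<noteq> 0" for j
    using pos[of "idx j"] pos[of "Suc (idx j)"] idx[of j] by auto
  ultimately show ?thesis
    unfolding r_vec_def norm_share_limit_def Let_def
    using A pos[of K] pos[of "K + 1"] K
    by (intro continuous_on_vec_lambda continuous_intros) auto
qed

section \<open>Consistency of the estimator\<close>

lemma top_share_diff:
  "top_share n y q' - top_share n y q
     = (top_sum n y (nat \<lfloor>real n * q'\<rfloor>) - top_sum n y (nat \<lfloor>real n * q\<rfloor>)) / top_sum n y n"
  unfolding top_share_def top_sum_def diff_divide_distrib ..

text \<open>
  The total sum cancels between numerator and denominator, so only the blocks matter. As the last block
  has a nonzero limit, the two shares in the denominator are eventually different; this is the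
  condition under which the estimator is required to minimize the criterion.
\<close>

lemma norm_share_tendsto:
  fixes N :: "nat \<Rightarrow> nat" and y :: "nat \<Rightarrow> nat \<Rightarrow> real"
  assumes N: "\<And>j. 1 \<le> N j"
    and pos: "\<And>j i. i \<in> {1..N j} \<Longrightarrow> 0 < y j i"
    and slice: "\<And>k. k \<in> {1..K} \<Longrightarrow>
      (\<lambda>j. (top_sum (N j) (y j) (nat \<lfloor>real (N j) * p (k + 1)\<rfloor>)
          - top_sum (N j) (y j) (nat \<lfloor>real (N j) * p k\<rfloor>)) / real (N j)) \<longlonglongrightarrow> v k"
    and K: "1 \<le> K" and v: "v K \<noteq> 0"
  shows "k \<in> {1..K} \<Longrightarrow> (\<lambda>j. norm_share K p (N j) (y j) k) \<longlonglongrightarrow> v k / v K"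
    and "\<forall>\<^sub>F j in sequentially. top_share (N j) (y j) (p (K + 1)) \<noteq> top_share (N j) (y j) (p K)"
proof -
  define D where "D k j = (top_sum (N j) (y j) (nat \<lfloor>real (N j) * p (k + 1)\<rfloor>)
          - top_sum (N j) (y j) (nat \<lfloor>real (N j) * p k\<rfloor>)) / real (N j)" for k j
  define T where "T j = top_sum (N j) (y j) (N j) / real (N j)" for j
  have n: "0 < real (N j)" for j using N[of j] by simp
  have T: "0 < T j" for j
  proof -
    have "0 < (\<Sum>i = 1..N j. y j i)" using N[of j] pos[of _ j] by (intro sum_pos) auto
    then show ?thesis using n[of j] by (simp only: T_def top_sum_all divide_pos_pos)
  qed
  have diff: "top_share (N j) (y j) (p (k + 1)) - top_share (N j) (y j) (p k) = D k j / T j" for k j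
    unfolding top_share_diff D_def T_def using n[of j] by simp
  have D: "D k \<longlonglongrightarrow> v k" if "k \<in> {1..K}" for k
    using slice[OF that] unfolding D_def .
  show "(\<lambda>j. norm_share K p (N j) (y j) k) \<longlonglongrightarrow> v k / v K" if "k \<in> {1..K}"
  proof -
    have "norm_share K p (N j) (y j) k = D k j / D K j" for j
      unfolding norm_share_def diff using T[of j] by simp
    then show ?thesis using tendsto_divide[OF D[OF that] D[of K] v] K by simp
  qed
  have "\<forall>\<^sub>F j in sequentially. D K j \<noteq> 0"
    using D[of K] K v by (intro tendsto_imp_eventually_ne) auto
  then show "\<forall>\<^sub>F j in sequentially. top_share (N j) (y j) (p (K + 1)) \<noteq> top_share (N j) (y j) (p K)"
  proof eventually_elim
    case (elim j)
    then have "D K j / T j \<noteq> 0" using T[of j] by simp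
    then show ?case unfolding diff[symmetric] by simp
  qed
qed

theorem theorem3p3:
  fixes M :: "'a measure"
    and Y :: "nat \<Rightarrow> 'a \<Rightarrow> real"
    and K :: nat
    and p :: "nat \<Rightarrow> real"
    and idx :: "'k::finite \<Rightarrow> nat"
    and A :: "real set"
    and \<alpha>0 c :: real
    and What :: "nat \<Rightarrow> 'a \<Rightarrow> real ^ 'k ^ 'k"
    and W :: "real ^ 'k ^ 'k"
    and \<alpha>hat :: "nat \<Rightarrow> 'a \<Rightarrow> real"
  assumes "prob_space M"
    and "K \<ge> 2"
    and "bij_betw idx UNIV {1..K - 1}"
    and "0 < p 1" and "strict_mono_on {1..K + 1} p" and "p (K + 1) \<le> 1"
    and "compact A" and "A \<subseteq> {1<..}" and "\<alpha>0 \<in> A"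
    and "c > 0"
    and "prob_space.indep_vars M (\<lambda>_. borel) Y {1..}"
    and "\<And>i y. i \<ge> 1 \<Longrightarrow> cdf (distr M borel (Y i)) y = pareto_cdf \<alpha>0 c y"
    and "\<And>n. n \<ge> 1 \<Longrightarrow> What n \<in> borel_measurable M"
    and "\<And>n. n \<ge> 1 \<Longrightarrow>
           AE \<omega> in M. transpose (What n \<omega>) = What n \<omega> \<and> pos_def_matrix (What n \<omega>)"
    and "tendsto_in_prob M What W"
    and "pos_def_matrix W"
    and "\<And>n. n \<ge> 1 \<Longrightarrow> \<alpha>hat n \<in> borel_measurable M"
    and "\<And>n. n \<ge> 1 \<Longrightarrow>
           AE \<omega> in M.
             (let S = \<lambda>k. top_share n (\<lambda>i. Y i \<omega>) (p k);
                  s = s_vec idx K p n (\<lambda>i. Y i \<omega>)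
              in S (K + 1) \<noteq> S K \<longrightarrow>
                 is_arg_min
                   (\<lambda>\<alpha>. (r_vec idx K p \<alpha> - s) \<bullet> (What n \<omega> *v (r_vec idx K p \<alpha> - s)))
                   (\<lambda>\<alpha>. \<alpha> \<in> A) (\<alpha>hat n \<omega>))"
  shows "tendsto_in_prob M \<alpha>hat \<alpha>0"
proof -
  note K = assms(2) and idx = assms(3) and p1 = assms(4) and p_mono = assms(5) and p_le = assms(6)
    and A = assms(7-9) and c = assms(10) and indep = assms(11) and cdf = assms(12)
  interpret prob_space M by fact
  have \<alpha>0: "1 < \<alpha>0" using A by auto
  have Y [measurable]: "random_variable borel (Y i)" if "1 \<le> i" for i
    using indep that unfolding indep_vars_def by auto
  have p_mono': "p k \<le> p l" if "1 \<le> k" "k \<le> l" "l \<le> K + 1" for k l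
    using monotone_onD[OF strict_mono_on_imp_mono_on[OF p_mono], of k l] that by simp
  have p: "0 < p k" "p k \<le> 1" if "k \<in> {1..K + 1}" for k
    using p_mono'[of 1 k] p_mono'[of k "K + 1"] that p1 p_le by auto
  define D where "D = distr M borel (Y 1)"
  have D: "real_distribution D"
    unfolding D_def by (rule real_distribution_distr) simp
  have D_cdf: "cdf D y = pareto_cdf \<alpha>0 c y" for y
    unfolding D_def using cdf by simp
  have distr_Y: "distr M borel (Y i) = D" if "1 \<le> i" for i
  proof (rule cdf_unique[OF real_distribution_distr D])
    show "cdf (distr M borel (Y i)) = cdf D" using cdf[OF that] D_cdf by (intro ext) simp
  qed (use Y that in simp)
  have Y_pos: "AE w in M. \<forall>i\<in>{1..}. 0 < Y i w"
  proof (rule AE_ball_countable')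
    fix i :: nat assume "i \<in> {1..}"
    then have i: "1 \<le> i" by simp
    interpret D: real_distribution D by fact
    have "D.prob {..c} = 0" using D_cdf[of c] c by (simp add: cdf_def pareto_cdf_def)
    then have "AE x in D. x \<notin> {..c}" by (subst D.prob_eq_0[symmetric]) auto
    then have "AE x in distr M borel (Y i). x \<notin> {..c}" unfolding distr_Y[OF i] .
    then have "AE w in M. Y i w \<notin> {..c}" using Y[OF i] by (subst (asm) AE_distr_iff) auto
    then show "AE w in M. 0 < Y i w" by (rule eventually_mono) (use c in auto)
  qed simp

  define t where "t k = pareto_tail_quantile \<alpha>0 c (p k)" for k
  \<comment> \<open>Any tail probability strictly between \<open>0\<close> and \<open>p 1\<close> would serve for \<open>L\<close>: eventually fewer than \<open>n p 1\<close>
    observations exceed \<open>L\<close>, so all blocks in question lie below it.\<close>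
  define L where "L = pareto_tail_quantile \<alpha>0 c (p 1 / 2)"
  define slice where "slice k x = x * indicator {t (k + 1)<..t k} x" for k x
  define G where "G = {indicator {L<..}} \<union> (\<lambda>k. indicator {t k<..}) ` {1..K + 1} \<union> slice ` {1..K}"
  define v where "v k = \<alpha>0 / (\<alpha>0 - 1) * c * (p (k + 1) powr (1 - 1 / \<alpha>0) - p k powr (1 - 1 / \<alpha>0))" for k
  have t_ge: "c \<le> t k" if "k \<in> {1..K + 1}" for k
    unfolding t_def using p[OF that] \<alpha>0 c by (intro pareto_tail_quantile_ge) auto
  have t_mono: "t l \<le> t k" if "1 \<le> k" "k \<le> l" "l \<le> K + 1" for k l
    unfolding t_def using p[of k] p_mono'[OF that] that \<alpha>0 c
    by (intro pareto_tail_quantile_antimono) auto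
  have L_ge: "t k \<le> L" if "k \<in> {1..K + 1}" for k
    unfolding t_def L_def using p_mono'[of 1 k] that \<alpha>0 c p1
    by (intro pareto_tail_quantile_antimono) auto
  have G: "g \<in> borel_measurable borel \<and> (\<exists>B. \<forall>x. \<bar>g x\<bar> \<le> B)" if g: "g \<in> G" for g
  proof -
    consider s where "g = indicator {s<..}" | k where "k \<in> {1..K}" "g = slice k"
      using g unfolding G_def by blast
    then show ?thesis
    proof cases
      case 1
      then show ?thesis by (auto simp: indicator_def intro!: exI[of _ 1])
    next
      case 2
      have "0 < t (k + 1)" using t_ge[of "k + 1"] c 2 by auto
      then have "\<bar>g x\<bar> \<le> t k" if "x \<in> {t (k + 1)<..t k}" for x
        using 2 that by (auto simp: slice_def)
      moreover have "\<bar>g x\<bar> \<le> t k" if "x \<notin> {t (k + 1)<..t k}" for x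
        using 2 that t_ge[of k] c by (auto simp: slice_def)
      ultimately have "\<forall>x. \<bar>g x\<bar> \<le> t k" by blast
      moreover have "g \<in> borel_measurable borel" unfolding 2 slice_def by measurable
      ultimately show ?thesis by blast
    qed
  qed

  \<comment> \<open>The finitely many statistics that control everything else: the empirical means of the
    functions in \<open>G\<close>, and, at the index \<open>None\<close>, the distance of the weighting matrix from \<open>W\<close>.\<close>
  define X where "X i n w = (case i of None \<Rightarrow> dist (What n w) W
      | Some g \<Rightarrow> emp_mean n (\<lambda>i. Y i w) g)" for i n w
  define x where "x i = (case i of None \<Rightarrow> 0 | Some g \<Rightarrow> \<integral>z. g z \<partial>D)"
    for i :: "(real \<Rightarrow> real) option"
  define P where "P n w \<longleftrightarrow> (\<forall>i\<in>{1..}. 0 < Y i w) \<and>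
      (let S = \<lambda>k. top_share n (\<lambda>i. Y i w) (p k);
           s = s_vec idx K p n (\<lambda>i. Y i w)
       in S (K + 1) \<noteq> S K \<longrightarrow>
          is_arg_min
            (\<lambda>\<alpha>. (r_vec idx K p \<alpha> - s) \<bullet> (What n w *v (r_vec idx K p \<alpha> - s)))
            (\<lambda>\<alpha>. \<alpha> \<in> A) (\<alpha>hat n w))" for n w
  show ?thesis
  proof (rule tendsto_in_prob_via_sequences)
    show "finite (insert None (Some ` G))" unfolding G_def by simp
    show "tendsto_in_prob M (X i) (x i)" if "i \<in> insert None (Some ` G)" for i
    proof (cases i)
      case None
      then show ?thesis using assms(15) by (simp add: tendsto_in_prob_def X_def x_def)
    next
      case (Some g)
      then have "g \<in> G" using that by auto
      with G obtain B where "g \<in> borel_measurable borel" "\<And>x. \<bar>g x\<bar> \<le> B" by blast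
      from weak_law_bounded[OF indep distr_Y this] show ?thesis
        by (simp add: Some X_def[abs_def] x_def)
    qed
    show "X i n \<in> borel_measurable M" if "i \<in> insert None (Some ` G)" "1 \<le> n" for i n
    proof (cases i)
      case None
      then show ?thesis unfolding X_def[abs_def] using assms(13)[OF that(2)] by simp
    next
      case (Some g)
      then have [measurable]: "g \<in> borel_measurable borel" using that G by auto
      show ?thesis unfolding X_def[abs_def] emp_mean_def Some option.case by measurable
    qed
    show "AE w in M. P n w" if "1 \<le> n" for n
      using assms(18)[OF that] Y_pos unfolding P_def by eventually_elim blast
  next
    \<comment> \<open>From here on the sample points form a fixed sequence and all limits are ordinary limits.\<close>
    fix N :: "nat \<Rightarrow> nat" and w :: "nat \<Rightarrow> 'a"
    assume N: "filterlim N at_top sequentially" and NP: "\<And>j. 1 \<le> N j \<and> P (N j) (w j)"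
      and lim: "\<And>i. i \<in> insert None (Some ` G) \<Longrightarrow> (\<lambda>j. X i (N j) (w j)) \<longlonglongrightarrow> x i"
    define y where "y j i = Y i (w j)" for j i
    have pos: "0 < y j i" if "i \<in> {1..N j}" for i j
      using NP[of j] that unfolding P_def y_def by simp
    have lim_G: "(\<lambda>j. emp_mean (N j) (y j) g) \<longlonglongrightarrow> (\<integral>z. g z \<partial>D)" if "g \<in> G" for g
      using lim[of "Some g"] that unfolding X_def x_def y_def[abs_def] by simp
    have lim_W: "(\<lambda>j. What (N j) (w j)) \<longlonglongrightarrow> W"
      using lim[of None] by (subst tendsto_dist_iff) (simp add: X_def x_def)
    have lim_L: "(\<lambda>j. emp_mean (N j) (y j) (indicator {L<..})) \<longlonglongrightarrow> p 1 / 2"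
    proof -
      have "(\<integral>z. indicator {L<..} z \<partial>D) = p 1 / 2"
        unfolding L_def using \<alpha>0 c p[of 1] by (intro pareto_tail_prob[OF D D_cdf]) auto
      moreover have "indicator {L<..} \<in> G" unfolding G_def by blast
      ultimately show ?thesis using lim_G[of "indicator {L<..}"] by (simp only:)
    qed
    have lim_t: "(\<lambda>j. emp_mean (N j) (y j) (indicator {t k<..})) \<longlonglongrightarrow> p k" if "k \<in> {1..K + 1}" for k
    proof -
      have "(\<integral>z. indicator {t k<..} z \<partial>D) = p k"
        unfolding t_def using \<alpha>0 c p[OF that] by (intro pareto_tail_prob[OF D D_cdf]) auto
      moreover have "indicator {t k<..} \<in> G" using that unfolding G_def by blast
      ultimately show ?thesis using lim_G[of "indicator {t k<..}"] by (simp only:)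
    qed
    have lim_v: "(\<lambda>j. emp_mean (N j) (y j) (slice k)) \<longlonglongrightarrow> v k" if "k \<in> {1..K}" for k
    proof -
      have "(\<integral>z. slice k z \<partial>D) = v k"
        unfolding slice_def v_def t_def
        using that p[of k] p[of "k + 1"] p_mono'[of k "k + 1"] \<alpha>0 c
        by (intro pareto_slice_mean[OF D D_cdf]) auto
      then show ?thesis using lim_G[of "slice k"] that by (simp add: G_def)
    qed
    have lim_slice: "(\<lambda>j. (top_sum (N j) (y j) (nat \<lfloor>real (N j) * p (k + 1)\<rfloor>)
          - top_sum (N j) (y j) (nat \<lfloor>real (N j) * p k\<rfloor>)) / real (N j)) \<longlonglongrightarrow> v k"
      if k: "k \<in> {1..K}" for k
    proof (rule top_sum_slice_tendsto[OF N _ _ _ _ _ _ _ lim_L])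
      show "0 \<le> y j i" if "i \<in> {1..N j}" for i j using pos[OF that] by simp
      show "0 < p k" "p k \<le> p (k + 1)" "p (k + 1) \<le> 1" "p 1 / 2 < p k"
        using k p[of k] p[of "k + 1"] p_mono'[of k "k + 1"] p_mono'[of 1 k] p1 by auto
      show "t (k + 1) \<le> t k" "t k \<le> L" using k t_mono[of k "k + 1"] L_ge[of k] by auto
      show "(\<lambda>j. emp_mean (N j) (y j) (indicator {t k<..})) \<longlonglongrightarrow> p k" using k by (intro lim_t) auto
      show "(\<lambda>j. emp_mean (N j) (y j) (indicator {t (k + 1)<..})) \<longlonglongrightarrow> p (k + 1)"
        using k by (intro lim_t) auto
      show "(\<lambda>j. emp_mean (N j) (y j) (\<lambda>x. x * indicator {t (k + 1)<..t k} x)) \<longlonglongrightarrow> v k"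
        using lim_v[OF k] unfolding slice_def[abs_def] .
    qed
    have vK: "v K \<noteq> 0"
    proof -
      have "p K < p (K + 1)" using K by (intro strict_mono_onD[OF p_mono]) auto
      then have "p K powr (1 - 1 / \<alpha>0) < p (K + 1) powr (1 - 1 / \<alpha>0)"
        using p[of K] K \<alpha>0 by (intro powr_less_mono2) auto
      then show ?thesis using c \<alpha>0 by (simp add: v_def)
    qed
    have K1: "1 \<le> K" using K by simp
    have N1: "1 \<le> N j" for j using NP by blast
    have idx_in: "idx i \<in> {1..K - 1}" for i using idx by (auto simp: bij_betw_def)
    have idx_K: "idx i \<in> {1..K}" for i using idx_in[of i] by auto
    have lim_share: "(\<lambda>j. norm_share K p (N j) (y j) k) \<longlonglongrightarrow> v k / v K" if "k \<in> {1..K}" for k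
      by (rule norm_share_tendsto(1)[OF N1 pos lim_slice K1 vK that])
    have share_ne: "\<forall>\<^sub>F j in sequentially.
        top_share (N j) (y j) (p (K + 1)) \<noteq> top_share (N j) (y j) (p K)"
      by (rule norm_share_tendsto(2)[OF N1 pos lim_slice K1 vK])
    have lim_s: "(\<lambda>j. s_vec idx K p (N j) (y j)) \<longlonglongrightarrow> r_vec idx K p \<alpha>0"
    proof (rule vec_tendstoI)
      fix i
      have "v (idx i) / v K = norm_share_limit K p \<alpha>0 (idx i)"
        using c \<alpha>0 by (simp add: v_def norm_share_limit_def Let_def)
      then show "(\<lambda>j. s_vec idx K p (N j) (y j) $ i) \<longlonglongrightarrow> r_vec idx K p \<alpha>0 $ i"
        using lim_share[OF idx_K[of i]] by (simp add: s_vec_def r_vec_def)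
    qed
    show "(\<lambda>j. \<alpha>hat (N j) (w j)) \<longlonglongrightarrow> \<alpha>0"
    proof (rule argmin_tendsto[where r = "r_vec idx K p", OF A(1) A(3) _ _ lim_s lim_W assms(16)])
      show "continuous_on A (r_vec idx K p)"
        by (rule r_vec_continuous[OF p1 p_mono K1 idx_K A(2)])
      show "a = \<alpha>0" if "a \<in> A" "r_vec idx K p a = r_vec idx K p \<alpha>0" for a
        using r_vec_inj[OF K idx p1 p_mono _ \<alpha>0 that(2)] that(1) A(2) by auto
      show "\<forall>\<^sub>F j in sequentially. is_arg_min
          (\<lambda>a. (r_vec idx K p a - s_vec idx K p (N j) (y j)) \<bullet>
             (What (N j) (w j) *v (r_vec idx K p a - s_vec idx K p (N j) (y j))))
          (\<lambda>a. a \<in> A) (\<alpha>hat (N j) (w j))"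
        using share_ne
      proof eventually_elim
        case (elim j)
        then show ?case using NP[of j] unfolding P_def Let_def y_def[abs_def] by blast
      qed
    qed
  qed
qed

end
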